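(* Let $A\in\mathbb{R}^{3\times 3}$ be an upper triangular $Z$-matrix whose diagonal entries are all nonnegative. If $A$ is a Karamardian matrix, then $A$ is range monotone.
   Context: A $Z$-matrix is a real square matrix whose off-diagonal entries are nonpositive. A square matrix $M$ is range monotone if $Mx\ge 0$ and $x\in R(M)$ imply $x\ge 0$. For $A\in\mathbb{R}^{n\times n}$ let $K_A=\mathbb{R}^n_+\cap R(A)$ and $K_A^*=\{y\in\mathbb{R}^n: x^Ty\ge 0 \text{ for all } x\in K_A\}$ (one has $K_A^*=\mathbb{R}^n_++N(A^T)$, and its interior is $\{a+b: a>0,\ b\in N(A^T)\}$). For $q\in\mathbb{R}^n$, LCP$(A,K_A,q)$ is to find $x$ with $x\in K_A$, $Ax+q\in K_A^*$, $x^T(Ax+q)=0$. $A$ is a Karamardian matrix if $K_A\ne\{0\}$ and there exists $d$ in the interior of $K_A^*$ such that both LCP$(A,K_A,0)$ and LCP$(A,K_A,d)$ have $x=0$ as their only solution. *)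

theory Defs
  imports "HOL-Analysis.Analysis"
begin

text \<open>Vectors in R^n are \<open>real^'n\<close>, matrices are \<open>real^'n^'n\<close>; x >= 0 is componentwise.\<close>

definition nonneg_vec :: "real^'n \<Rightarrow> bool" where
  "nonneg_vec x \<longleftrightarrow> (\<forall>i. 0 \<le> x $ i)"

definition z_matrix :: "real^'n^'n \<Rightarrow> bool" where
  "z_matrix A \<longleftrightarrow> (\<forall>i j. i \<noteq> j \<longrightarrow> A $ i $ j \<le> 0)"

definition range_monotone :: "real^'n^'n \<Rightarrow> bool" where
  "range_monotone M \<longleftrightarrow>
     (\<forall>x. nonneg_vec (M *v x) \<and> x \<in> range ((*v) M) \<longrightarrow> nonneg_vec x)"

definition K_cone :: "real^'n^'n \<Rightarrow> (real^'n) set" where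
  "K_cone A = {x. nonneg_vec x} \<inter> range ((*v) A)"

definition dual_cone :: "(real^'n) set \<Rightarrow> (real^'n) set" where
  "dual_cone K = {y. \<forall>x\<in>K. 0 \<le> x \<bullet> y}"

definition LCP_solution :: "real^'n^'n \<Rightarrow> real^'n \<Rightarrow> real^'n \<Rightarrow> bool" where
  "LCP_solution A q x \<longleftrightarrow>
     x \<in> K_cone A \<and> A *v x + q \<in> dual_cone (K_cone A) \<and> x \<bullet> (A *v x + q) = 0"

definition karamardian :: "real^'n^'n \<Rightarrow> bool" where
  "karamardian A \<longleftrightarrow> K_cone A \<noteq> {0} \<and>
     (\<exists>d \<in> interior (dual_cone (K_cone A)).
        (\<forall>x. LCP_solution A 0 x \<longrightarrow> x = 0) \<and> (\<forall>x. LCP_solution A d x \<longrightarrow> x = 0))"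

end

theory Submission
  imports Defs
begin

(* A nonzero z \<in> K_A with Az = 0 would be a nontrivial solution of LCP(A, K_A, 0), so a
   Karamardian matrix has K_A \<inter> N(A) = {0}; nothing else about it is used. For an upper
   triangular Z-matrix with nonnegative diagonal, x = Ay and Ax \<ge> 0 give x \<ge> 0 row by row,
   from the last row up: a positive diagonal entry settles its row directly, and each
   degenerate pattern of zero diagonal entries either forces the corresponding off-diagonal
   entries to vanish or yields an explicit nonzero vector in K_A \<inter> N(A). *)

lemma nonneg_vec_in_dual_K_cone: "nonneg_vec y \<Longrightarrow> y \<in> dual_cone (K_cone A)"
  unfolding dual_cone_def K_cone_def nonneg_vec_def inner_vec_def
  by (auto intro: sum_nonneg)

lemma LCP_solution_zero_if_null: "z \<in> K_cone A \<Longrightarrow> A *v z = 0 \<Longrightarrow> LCP_solution A 0 z"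
  unfolding LCP_solution_def by (simp add: nonneg_vec_in_dual_K_cone nonneg_vec_def)

lemma karamardian_K_cone_null_trivial:
  "karamardian A \<Longrightarrow> z \<in> K_cone A \<Longrightarrow> A *v z = 0 \<Longrightarrow> z = 0"
  unfolding karamardian_def using LCP_solution_zero_if_null by blast

(* The matrix M = [a b c; 0 d e; 0 0 f]; K_null_trivial says K_M \<inter> N(M) = {0}. *)
locale upper_triangular_Z3 =
  fixes a b c d e f :: real
  assumes diag_nonneg: "0 \<le> a" "0 \<le> d" "0 \<le> f"
    and offdiag_nonpos: "b \<le> 0" "c \<le> 0" "e \<le> 0"
    and K_null_trivial: "\<And>z1 z2 z3 w1 w2 w3.
      z1 = a*w1 + b*w2 + c*w3 \<Longrightarrow> z2 = d*w2 + e*w3 \<Longrightarrow> z3 = f*w3 \<Longrightarrow>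
      0 \<le> z1 \<Longrightarrow> 0 \<le> z2 \<Longrightarrow> 0 \<le> z3 \<Longrightarrow>
      a*z1 + b*z2 + c*z3 = 0 \<Longrightarrow> d*z2 + e*z3 = 0 \<Longrightarrow> f*z3 = 0 \<Longrightarrow>
      z1 = 0 \<and> z2 = 0 \<and> z3 = 0"
begin

lemma first_row_vanishes_on_kernel:
  assumes "a = 0" "d*w2 + e*w3 = 0" "f*w3 = 0"
  shows "b*w2 + c*w3 = 0"
(* Otherwise e\<^sub>1 \<in> R(M), while M e\<^sub>1 = 0 because a = 0. *)
proof (rule ccontr)
  define s where "s = b*w2 + c*w3"
  assume "b*w2 + c*w3 \<noteq> 0"
  then have "1 = a*0 + b*(w2/s) + c*(w3/s)" "0 = d*(w2/s) + e*(w3/s)" "0 = f*(w3/s)"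
    using assms by (simp_all add: s_def add_divide_distrib[symmetric] divide_simps)
  from K_null_trivial[OF this] show False using assms(1) by simp
qed

lemma b_zero: "a = 0 \<Longrightarrow> d = 0 \<Longrightarrow> b = 0"
  using first_row_vanishes_on_kernel[of 1 0] by simp

lemma e_zero:
  assumes "d = 0" "f = 0"
  shows "e = 0"
(* Otherwise (-b, a, 0) if a > 0, resp. (-c, -e, 0) if a = 0, lies in K_M \<inter> N(M). *)
proof (rule ccontr)
  assume "e \<noteq> 0"
  consider "0 < a" | "a = 0" using diag_nonneg by linarith
  then show False
  proof cases
    case 1
    then have "-b = a*((-b - c*a/e)/a) + b*0 + c*(a/e)" using \<open>e \<noteq> 0\<close>
      by (simp add: field_simps)
    from K_null_trivial[OF this, of a 0] show False
      using 1 \<open>e \<noteq> 0\<close> assms offdiag_nonpos by simp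
  next
    case 2
    then have "b = 0" using b_zero assms by simp
    from K_null_trivial[of "-c" 0 0 "-1" "-e" 0] show False
      using 2 \<open>b = 0\<close> \<open>e \<noteq> 0\<close> assms offdiag_nonpos by simp
  qed
qed

lemma c_zero: "a = 0 \<Longrightarrow> d = 0 \<Longrightarrow> f = 0 \<Longrightarrow> c = 0"
  using first_row_vanishes_on_kernel[of 0 1] e_zero by simp

lemma minor_det_zero: "a = 0 \<Longrightarrow> f = 0 \<Longrightarrow> b*e = c*d"
  using first_row_vanishes_on_kernel[of e "-d"] by (simp add: algebra_simps)

end

locale upper_triangular_Z3_preimage = upper_triangular_Z3 +
  fixes x1 x2 x3 y1 y2 y3 :: real
  assumes x_eq: "x1 = a*y1 + b*y2 + c*y3" "x2 = d*y2 + e*y3" "x3 = f*y3"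
    and image_nonneg: "0 \<le> a*x1 + b*x2 + c*x3" "0 \<le> d*x2 + e*x3" "0 \<le> f*x3"
begin

lemma y3_nonneg: "0 < f \<Longrightarrow> 0 \<le> y3"
  using image_nonneg(3) x_eq(3) by (simp add: zero_le_mult_iff)

lemma x3_nonneg: "0 \<le> x3"
  using y3_nonneg x_eq(3) diag_nonneg by (cases "f = 0") auto

lemma e_y3_zero:
  assumes "0 < f" "d*x2 \<le> 0"
  shows "e*y3 = 0"
proof -
  have "0 \<le> f*(e*y3)" using image_nonneg(2) assms(2) x_eq(3) by (simp add: algebra_simps)
  then have "0 \<le> e*y3" using assms(1) by (simp add: zero_le_mult_iff)
  moreover have "e*y3 \<le> 0" using y3_nonneg[OF assms(1)] offdiag_nonpos(3) by (simp add: mult_nonpos_nonneg)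
  ultimately show ?thesis by linarith
qed

lemma x2_nonneg: "0 \<le> x2"
proof (cases "d = 0")
  case True
  have "e*y3 = 0"
    using e_y3_zero True e_zero diag_nonneg by (cases "f = 0") auto
  then show ?thesis using True x_eq(2) by auto
next
  case False
  have "e*x3 \<le> 0" using offdiag_nonpos x3_nonneg by (simp add: mult_nonpos_nonneg)
  then have "0 \<le> d*x2" using image_nonneg(2) by linarith
  then show ?thesis using False diag_nonneg by (simp add: zero_le_mult_iff)
qed

lemma first_row_terms_nonpos: "b*x2 \<le> 0" "c*x3 \<le> 0"
  using offdiag_nonpos x2_nonneg x3_nonneg by (simp_all add: mult_nonpos_nonneg)

lemma x1_nonneg_if_a_zero:
  assumes a0: "a = 0"
  shows "0 \<le> x1"
proof -
  have "0 \<le> b*x2 + c*x3" using image_nonneg(1) a0 by simp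
  then have bx2: "b*x2 = 0" and cx3: "c*x3 = 0" using first_row_terms_nonpos by linarith+
  have cy3: "c*y3 = 0" if "0 < f" using cx3 x_eq(3) that by simp
  consider "d = 0" | "0 < d" "0 < f" | "0 < d" "f = 0" using diag_nonneg by linarith
  then show ?thesis
  proof cases
    case 1
    then have "b = 0" using b_zero a0 by simp
    moreover have "c*y3 = 0"
      using cy3 c_zero a0 1 diag_nonneg by (cases "f = 0") auto
    ultimately show ?thesis using x_eq(1) a0 by auto
  next
    case 2
    have "b*y2 = 0"
    proof (cases "b = 0")
      case False
      then have "x2 = 0" using bx2 by simp
      then have "d*y2 = 0" using e_y3_zero 2 x_eq(2) by auto
      then show ?thesis using 2 by simp
    qed simp
    then show ?thesis using x_eq(1) a0 cy3 2 by auto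
  next
    case 3
    have "d*x1 = b*x2" using x_eq minor_det_zero a0 3 by (simp add: algebra_simps)
    then show ?thesis using bx2 3 by simp
  qed
qed

lemma x1_nonneg: "0 \<le> x1"
proof (cases "a = 0")
  case False
  then have "0 < a" using diag_nonneg by simp
  moreover have "0 \<le> a*x1" using image_nonneg(1) first_row_terms_nonpos by linarith
  ultimately show ?thesis by (simp add: zero_le_mult_iff)
qed (rule x1_nonneg_if_a_zero)

end

(* In the type 3 the numeral 3 is 0, the least index, so the index order is 3 < 1 < 2. *)
lemma less_index_3: "(3::3) < 1" "(1::3) < 2" "(3::3) < 2"
  by (simp_all add: less_bit1_def bit1.Rep_0 bit1.Rep_1 bit1.Rep_numeral)

lemma nonneg_vec_3: "nonneg_vec (v::real^3) \<longleftrightarrow> 0 \<le> v$1 \<and> 0 \<le> v$2 \<and> 0 \<le> v$3"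
  unfolding nonneg_vec_def forall_3 by blast

lemma upper_triangular_3_mult_vector:
  fixes A :: "real^3^3"
  assumes "\<forall>i j. j < i \<longrightarrow> A$i$j = 0"
  shows "(A *v v)$3 = A$3$3 * v$3 + A$3$1 * v$1 + A$3$2 * v$2"
    and "(A *v v)$1 = A$1$1 * v$1 + A$1$2 * v$2"
    and "(A *v v)$2 = A$2$2 * v$2"
  using assms less_index_3 by (auto simp: matrix_vector_mult_def sum_3)

lemma upper_triangular_Z3_matrix:
  fixes A :: "real^3^3"
  assumes "z_matrix A" and triangular: "\<forall>i j. j < i \<longrightarrow> A$i$j = 0"
    and "\<forall>i. 0 \<le> A$i$i" and null: "\<And>z. z \<in> K_cone A \<Longrightarrow> A *v z = 0 \<Longrightarrow> z = 0"
  shows "upper_triangular_Z3 (A$3$3) (A$3$1) (A$3$2) (A$1$1) (A$1$2) (A$2$2)"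
proof
  show "0 \<le> A$3$3" "0 \<le> A$1$1" "0 \<le> A$2$2" using assms(3) by simp_all
  show "A$3$1 \<le> 0" "A$3$2 \<le> 0" "A$1$2 \<le> 0"
    using assms(1) less_index_3 unfolding z_matrix_def by (metis order_less_irrefl)+
next
  fix z1 z2 z3 w1 w2 w3 :: real
  let ?z = "vector [z2, z3, z1] :: real^3" and ?w = "vector [w2, w3, w1] :: real^3"
  assume "z1 = A$3$3 * w1 + A$3$1 * w2 + A$3$2 * w3" "z2 = A$1$1 * w2 + A$1$2 * w3"
    "z3 = A$2$2 * w3" "0 \<le> z1" "0 \<le> z2" "0 \<le> z3"
    "A$3$3 * z1 + A$3$1 * z2 + A$3$2 * z3 = 0" "A$1$1 * z2 + A$1$2 * z3 = 0" "A$2$2 * z3 = 0"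
  then have "?z = A *v ?w" "nonneg_vec ?z" "A *v ?z = 0"
    by (simp_all add: vec_eq_iff forall_3 nonneg_vec_3 upper_triangular_3_mult_vector[OF triangular])
  then have "?z = 0" using null unfolding K_cone_def by blast
  then show "z1 = 0 \<and> z2 = 0 \<and> z3 = 0" by (simp add: vec_eq_iff forall_3)
qed

theorem mainTheorem9:
  fixes A :: "real^3^3"
  assumes "z_matrix A"
    and "\<forall>i j. j < i \<longrightarrow> A $ i $ j = 0"
    and "\<forall>i. 0 \<le> A $ i $ i"
    and "karamardian A"
  shows "range_monotone A"
  unfolding range_monotone_def
proof clarify
  fix y
  assume "nonneg_vec (A *v (A *v y))"
  interpret upper_triangular_Z3 "A$3$3" "A$3$1" "A$3$2" "A$1$1" "A$1$2" "A$2$2"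
    using upper_triangular_Z3_matrix assms karamardian_K_cone_null_trivial by blast
  interpret upper_triangular_Z3_preimage "A$3$3" "A$3$1" "A$3$2" "A$1$1" "A$1$2" "A$2$2"
    "(A *v y)$3" "(A *v y)$1" "(A *v y)$2" "y$3" "y$1" "y$2"
    using \<open>nonneg_vec (A *v (A *v y))\<close>
    by unfold_locales (simp_all add: nonneg_vec_3 upper_triangular_3_mult_vector[OF assms(2)])
  show "nonneg_vec (A *v y)"
    using x1_nonneg x2_nonneg x3_nonneg by (simp add: nonneg_vec_3)
qed

end
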